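(* Let $W$ be a finite Coxeter group and $c$ a standard Coxeter element. An element $u\in W_c^+$ and a chain $\vec\pi\in\mathsf{MC}(W,c)$ are concordant if and only if $\Delta(u)\subseteq\Delta(\vec\pi)$.
   Context: $W$ is a finite Coxeter group of rank $r$ acting by its reflection representation on a Euclidean space $V$, with reflecting hyperplanes $\mathcal H$, base region $\mathbb B$ (a connected component of $V\setminus\bigcup\mathcal H$), simple reflections $S$ (reflections in walls of $\mathbb B$) and reflections $T$. Let $V^*$ be the dual, $\langle\cdot,\cdot\rangle$ the pairing, $\Phi\subset V^*$ the root system of $W$; for $t\in T$ let $\beta_t$ be the root with $\langle\beta_t,\mathfrak y\rangle>0$ for $\mathfrak y\in\mathbb B$ and $t\mathfrak x=\mathfrak x-\langle\beta_t,\mathfrak x\rangle\beta_t^\vee$, where $\beta_t^\vee\in V$ is the coroot. $\ell_S,\ell_T$ denote lengths; Bruhat order covers $u\lessdot_{\mathrm B}v$ iff $v=ut$, $t\in T$, $\ell_S(v)=\ell_S(u)+1$; absolute order $u\leq_T v$ iff $\ell_T(u)+\ell_T(u^{-1}v)=\ell_T(v)$. A standard Coxeter element $c$ is a product of all elements of $S$ each once; $1-c^{-1}$ is invertible on $V$. $W_c^+=\{u:\ell_S(uc)=\ell_S(u)+r\}$. $\mathsf{MC}(W,c)$ is the set of maximal chains $\vec\pi=\{e=\pi_0\lessdot_T\cdots\lessdot_T\pi_r=c\}$ in $[e,c]_T$, and $t_i=\pi_{i-1}^{-1}\pi_i$. $u\in W_c^+$ and $\vec\pi$ are concordant if $u\pi_0\leq_{\mathrm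 B}u\pi_1\leq_{\mathrm B}\cdots\leq_{\mathrm B}u\pi_r$. Define $\delta_t=(1-c^{-1})^{-1}\beta_t^\vee$ for $t\in T$, $\Delta(u)=\overline{u^{-1}\mathbb B}$ (closure) for $u\in W_c^+$, and $\Delta(\vec\pi)=\mathrm{span}_{\geq0}\{\delta_{t_1},\ldots,\delta_{t_r}\}$ (nonnegative span). *)

theory Defs
  imports "HOL-Analysis.Analysis"
begin

text \<open>
  A finite Coxeter group is given concretely through its reflection representation, as a set of
  maps on \<open>V = 'a\<close>.  Group elements act on the left, so the product \<open>u v\<close> is \<open>u \<circ> v\<close>, the
  identity \<open>e\<close> is \<open>id\<close>, and inverses are inverse maps.
\<close>

definition is_reflection :: "('a::euclidean_space \<Rightarrow> 'a) \<Rightarrow> bool" where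
  "is_reflection t \<longleftrightarrow> (\<exists>a. a \<noteq> 0 \<and> t = (\<lambda>x. x - (2 * (a \<bullet> x) / (a \<bullet> a)) *\<^sub>R a))"

definition reflections :: "('a::euclidean_space \<Rightarrow> 'a) set \<Rightarrow> ('a \<Rightarrow> 'a) set" where
  "reflections W = {t \<in> W. is_reflection t}"

definition word_prod :: "('a \<Rightarrow> 'a) list \<Rightarrow> 'a \<Rightarrow> 'a" where
  "word_prod ws = foldr (\<circ>) ws id"

text \<open>
  The last conjunct says that the representation is essential, so that \<open>dim V\<close> is the rank
  and \<open>1 - c\<^sup>-\<^sup>1\<close> is invertible.
\<close>

definition finite_coxeter_group :: "('a::euclidean_space \<Rightarrow> 'a) set \<Rightarrow> bool" where
  "finite_coxeter_group W \<longleftrightarrow>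
     finite W \<and> id \<in> W \<and> (\<forall>v\<in>W. \<forall>w\<in>W. v \<circ> w \<in> W) \<and> (\<forall>w\<in>W. inv w \<in> W) \<and>
     (\<forall>w\<in>W. orthogonal_transformation w) \<and>
     (\<forall>w\<in>W. \<exists>ts. set ts \<subseteq> reflections W \<and> word_prod ts = w) \<and>
     (\<forall>x. (\<forall>w\<in>W. w x = x) \<longrightarrow> x = 0)"

definition fixed_space :: "('a \<Rightarrow> 'a) \<Rightarrow> 'a set" where
  "fixed_space w = {x. w x = x}"

definition hyperplanes :: "('a::euclidean_space \<Rightarrow> 'a) set \<Rightarrow> 'a set set" where
  "hyperplanes W = fixed_space ` reflections W"

definition base_region :: "('a::euclidean_space \<Rightarrow> 'a) set \<Rightarrow> 'a set \<Rightarrow> bool" where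
  "base_region W B \<longleftrightarrow> B \<in> components (UNIV - \<Union>(hyperplanes W))"

definition walls :: "('a::euclidean_space \<Rightarrow> 'a) set \<Rightarrow> 'a set \<Rightarrow> 'a set set" where
  "walls W B = {H \<in> hyperplanes W. (H \<inter> closure B) facet_of closure B}"

definition simple_reflections ::
    "('a::euclidean_space \<Rightarrow> 'a) set \<Rightarrow> 'a set \<Rightarrow> ('a \<Rightarrow> 'a) set" where
  "simple_reflections W B = {t \<in> reflections W. fixed_space t \<in> walls W B}"

definition cox_rank :: "('a::euclidean_space \<Rightarrow> 'a) set \<Rightarrow> 'a set \<Rightarrow> nat" where
  "cox_rank W B = card (simple_reflections W B)"

text \<open>
  Roots are linear functionals on \<open>V\<close>.  The normalization of root lengths is left open:
  \<open>\<Phi>\<close> is any \<open>W\<close>-stable choice of exactly one pair \<open>\<plusminus>\<phi>\<close> of functionals for each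
  reflecting hyperplane.
\<close>

definition root_system ::
    "('a::euclidean_space \<Rightarrow> 'a) set \<Rightarrow> ('a \<Rightarrow> real) set \<Rightarrow> bool" where
  "root_system W \<Phi> \<longleftrightarrow>
     (\<forall>\<phi>\<in>\<Phi>. linear \<phi> \<and> \<phi> \<noteq> (\<lambda>x. 0)) \<and>
     (\<forall>w\<in>W. \<forall>\<phi>\<in>\<Phi>. \<phi> \<circ> w \<in> \<Phi>) \<and>
     (\<forall>\<phi>\<in>\<Phi>. \<forall>k::real. (\<lambda>x. k * \<phi> x) \<in> \<Phi> \<longleftrightarrow> k = 1 \<or> k = -1) \<and>
     (\<lambda>\<phi>. {x. \<phi> x = 0}) ` \<Phi> = hyperplanes W"

text \<open>
  For a functional \<open>\<phi>\<close>, the vector \<open>adjoint \<phi> 1\<close> is its Riesz representative: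
  \<open>\<phi> x = x \<bullet> adjoint \<phi> 1\<close>.
\<close>

definition coroot :: "('a::euclidean_space \<Rightarrow> real) \<Rightarrow> 'a" where
  "coroot \<phi> = (let a = adjoint \<phi> 1 in (2 / (a \<bullet> a)) *\<^sub>R a)"

definition pos_root ::
    "'a::euclidean_space set \<Rightarrow> ('a \<Rightarrow> real) set \<Rightarrow> ('a \<Rightarrow> 'a) \<Rightarrow> 'a \<Rightarrow> real" where
  "pos_root B \<Phi> t =
     (THE \<beta>. \<beta> \<in> \<Phi> \<and> (\<forall>y\<in>B. \<beta> y > 0) \<and> (\<forall>x. t x = x - \<beta> x *\<^sub>R coroot \<beta>))"

definition word_length :: "('a \<Rightarrow> 'a) set \<Rightarrow> ('a \<Rightarrow> 'a) \<Rightarrow> nat" where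
  "word_length X w = (LEAST k. \<exists>ws. set ws \<subseteq> X \<and> length ws = k \<and> word_prod ws = w)"

abbreviation length_S ::
    "('a::euclidean_space \<Rightarrow> 'a) set \<Rightarrow> 'a set \<Rightarrow> ('a \<Rightarrow> 'a) \<Rightarrow> nat" where
  "length_S W B \<equiv> word_length (simple_reflections W B)"

abbreviation length_T :: "('a::euclidean_space \<Rightarrow> 'a) set \<Rightarrow> ('a \<Rightarrow> 'a) \<Rightarrow> nat" where
  "length_T W \<equiv> word_length (reflections W)"

definition bruhat_cover ::
    "('a::euclidean_space \<Rightarrow> 'a) set \<Rightarrow> 'a set \<Rightarrow> ('a \<Rightarrow> 'a) \<Rightarrow> ('a \<Rightarrow> 'a) \<Rightarrow> bool" where
  "bruhat_cover W B u v \<longleftrightarrow>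
     u \<in> W \<and> (\<exists>t\<in>reflections W. v = u \<circ> t) \<and> length_S W B v = length_S W B u + 1"

definition bruhat_le ::
    "('a::euclidean_space \<Rightarrow> 'a) set \<Rightarrow> 'a set \<Rightarrow> ('a \<Rightarrow> 'a) \<Rightarrow> ('a \<Rightarrow> 'a) \<Rightarrow> bool" where
  "bruhat_le W B = (bruhat_cover W B)\<^sup>*\<^sup>*"

definition absolute_le ::
    "('a::euclidean_space \<Rightarrow> 'a) set \<Rightarrow> ('a \<Rightarrow> 'a) \<Rightarrow> ('a \<Rightarrow> 'a) \<Rightarrow> bool" where
  "absolute_le W u v \<longleftrightarrow>
     u \<in> W \<and> v \<in> W \<and> length_T W u + length_T W (inv u \<circ> v) = length_T W v"

definition absolute_cover ::
    "('a::euclidean_space \<Rightarrow> 'a) set \<Rightarrow> ('a \<Rightarrow> 'a) \<Rightarrow> ('a \<Rightarrow> 'a) \<Rightarrow> bool" where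
  "absolute_cover W u v \<longleftrightarrow>
     absolute_le W u v \<and> u \<noteq> v \<and>
     \<not> (\<exists>w. absolute_le W u w \<and> absolute_le W w v \<and> w \<noteq> u \<and> w \<noteq> v)"

definition standard_coxeter_element ::
    "('a::euclidean_space \<Rightarrow> 'a) set \<Rightarrow> 'a set \<Rightarrow> ('a \<Rightarrow> 'a) \<Rightarrow> bool" where
  "standard_coxeter_element W B c \<longleftrightarrow>
     (\<exists>ss. distinct ss \<and> set ss = simple_reflections W B \<and> c = word_prod ss)"

definition W_plus ::
    "('a::euclidean_space \<Rightarrow> 'a) set \<Rightarrow> 'a set \<Rightarrow> ('a \<Rightarrow> 'a) \<Rightarrow> ('a \<Rightarrow> 'a) set" where
  "W_plus W B c = {u \<in> W. length_S W B (u \<circ> c) = length_S W B u + cox_rank W B}"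

text \<open>A chain \<open>\<pi>\<^sub>0, \<dots>, \<pi>\<^sub>r\<close> is a list indexed from 0.\<close>

definition MC ::
    "('a::euclidean_space \<Rightarrow> 'a) set \<Rightarrow> 'a set \<Rightarrow> ('a \<Rightarrow> 'a) \<Rightarrow> ('a \<Rightarrow> 'a) list set" where
  "MC W B c =
     {\<pi>. length \<pi> = cox_rank W B + 1 \<and> \<pi> ! 0 = id \<and> \<pi> ! cox_rank W B = c \<and>
         (\<forall>i\<in>{1..cox_rank W B}. absolute_cover W (\<pi> ! (i - 1)) (\<pi> ! i))}"

definition chain_refl :: "('a \<Rightarrow> 'a) list \<Rightarrow> nat \<Rightarrow> 'a \<Rightarrow> 'a" where
  "chain_refl \<pi> i = inv (\<pi> ! (i - 1)) \<circ> \<pi> ! i"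

definition concordant ::
    "('a::euclidean_space \<Rightarrow> 'a) set \<Rightarrow> 'a set \<Rightarrow> ('a \<Rightarrow> 'a) \<Rightarrow> ('a \<Rightarrow> 'a) list \<Rightarrow> bool" where
  "concordant W B u \<pi> \<longleftrightarrow>
     (\<forall>i\<in>{1..cox_rank W B}. bruhat_le W B (u \<circ> \<pi> ! (i - 1)) (u \<circ> \<pi> ! i))"

definition delta_vec ::
    "'a::euclidean_space set \<Rightarrow> ('a \<Rightarrow> real) set \<Rightarrow> ('a \<Rightarrow> 'a) \<Rightarrow> ('a \<Rightarrow> 'a) \<Rightarrow> 'a" where
  "delta_vec B \<Phi> c t = inv (\<lambda>x. x - inv c x) (coroot (pos_root B \<Phi> t))"

definition Delta_elem :: "'a::euclidean_space set \<Rightarrow> ('a \<Rightarrow> 'a) \<Rightarrow> 'a set" where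
  "Delta_elem B u = closure (inv u ` B)"

definition Delta_chain ::
    "('a::euclidean_space \<Rightarrow> 'a) set \<Rightarrow> 'a set \<Rightarrow> ('a \<Rightarrow> real) set \<Rightarrow> ('a \<Rightarrow> 'a) \<Rightarrow>
     ('a \<Rightarrow> 'a) list \<Rightarrow> 'a set" where
  "Delta_chain W B \<Phi> c \<pi> =
     {\<Sum>i=1..cox_rank W B. a i *\<^sub>R delta_vec B \<Phi> c (chain_refl \<pi> i) |a. \<forall>i. a i \<ge> 0}"

end

theory Submission
  imports Defs
begin

text \<open>
  Write \<open>c\<^sup>-\<^sup>1 = t\<^sub>r \<cdots> t\<^sub>1\<close>.  Telescoping along the chain gives, for every \<open>x\<close>,
  \<open>x - c\<^sup>-\<^sup>1 x = (\<Sum>i. \<langle>\<beta>\<^sub>i, \<pi>\<^bsub>i-1\<^esub>\<^sup>-\<^sup>1 x\<rangle> \<beta>\<^sub>i\<^sup>\<or>)\<close> with \<open>\<beta>\<^sub>i\<close> the positive root of \<open>t\<^sub>i\<close>.  Hence the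
  \<open>\<delta>\<close>-vectors of the chain span \<open>V\<close>; being \<open>r = dim V\<close> many, they form a basis in which the
  coordinates of \<open>x\<close> are \<open>\<langle>\<beta>\<^sub>i, \<pi>\<^bsub>i-1\<^esub>\<^sup>-\<^sup>1 x\<rangle>\<close>.  So \<open>\<Delta>(u) \<subseteq> \<Delta>(\<pi>)\<close> means that each \<open>\<beta>\<^sub>i\<close> is
  positive on \<open>(u \<pi>\<^bsub>i-1\<^esub>)\<^sup>-\<^sup>1 B\<close>, which by the strong exchange property means that right
  multiplication by \<open>t\<^sub>i\<close> increases the length of \<open>u \<pi>\<^bsub>i-1\<^esub>\<close>.  As the total increase from \<open>u\<close> to
  \<open>u c\<close> is exactly \<open>r\<close>, all these increases are Bruhat covers.
\<close>

section \<open>Reflections along a vector\<close>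

definition reflection_along :: "'a::euclidean_space \<Rightarrow> 'a \<Rightarrow> 'a" where
  "reflection_along a x = x - (2 * (a \<bullet> x) / (a \<bullet> a)) *\<^sub>R a"

lemma is_reflection_iff: "is_reflection t \<longleftrightarrow> (\<exists>a. a \<noteq> 0 \<and> t = reflection_along a)"
  by (simp add: is_reflection_def reflection_along_def fun_eq_iff)

lemma reflection_along_scaleR:
  assumes "k \<noteq> 0" shows "reflection_along (k *\<^sub>R a) = reflection_along a"
  using assms by (auto simp: reflection_along_def fun_eq_iff field_simps)

lemma reflection_along_minus: "reflection_along (- a) = reflection_along a"
  by (simp add: reflection_along_def fun_eq_iff)

lemma reflection_along_self: "a \<noteq> 0 \<Longrightarrow> reflection_along a a = - a"
  by (simp add: reflection_along_def scaleR_2)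

lemma reflection_along_involution:
  assumes "a \<noteq> 0" shows "reflection_along a (reflection_along a x) = x"
  using assms by (simp add: reflection_along_def inner_diff_right)

lemma inner_reflection_along: "x \<bullet> reflection_along a y = reflection_along a x \<bullet> y"
  by (simp add: reflection_along_def inner_diff inner_commute)

lemma fixed_space_reflection_along:
  assumes "a \<noteq> 0" shows "fixed_space (reflection_along a) = {x. a \<bullet> x = 0}"
  using assms by (auto simp: fixed_space_def reflection_along_def)

text \<open>Both reflections negate \<open>a\<close>, and the only vectors negated by the reflection
  along \<open>b\<close> are the multiples of \<open>b\<close>.\<close>

lemma reflection_along_parallel:
  assumes "reflection_along a = reflection_along b" "a \<noteq> 0" "b \<noteq> 0"
  shows "a = ((a \<bullet> b) / (b \<bullet> b)) *\<^sub>R b"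
proof -
  have "reflection_along b a = - a"
    using assms reflection_along_self by metis
  then have "2 *\<^sub>R a = (2 * (b \<bullet> a) / (b \<bullet> b)) *\<^sub>R b"
    by (simp add: reflection_along_def scaleR_2 algebra_simps)
  then have "(1/2) *\<^sub>R (2 *\<^sub>R a) = (1/2) *\<^sub>R ((2 * (b \<bullet> a) / (b \<bullet> b)) *\<^sub>R b)"
    by simp
  then show ?thesis by (simp add: inner_commute)
qed

text \<open>After normalization only a sign remains free; all later positivity arguments consist in
  deciding this sign.\<close>

lemma reflection_along_unit_eq:
  assumes "reflection_along a = reflection_along b" "norm a = 1" "norm b = 1"
  shows "a = b \<or> a = - b"
proof -
  have ne: "a \<noteq> 0" "b \<noteq> 0" using assms(2,3) by auto
  have eq: "a = (a \<bullet> b) *\<^sub>R b"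
    using reflection_along_parallel[OF assms(1) ne] assms(3) by (simp add: norm_eq_1)
  then have "\<bar>a \<bullet> b\<bar> * norm b = norm a" by (metis norm_scaleR)
  then have "a \<bullet> b = 1 \<or> a \<bullet> b = -1" using assms(2,3) by auto
  then show ?thesis using eq by (metis scaleR_minus1_left scaleR_one)
qed

lemma reflection_along_conj:
  fixes w :: "'a::euclidean_space \<Rightarrow> 'a"
  assumes "orthogonal_transformation w"
  shows "w \<circ> reflection_along a \<circ> inv w = reflection_along (w a)"
proof
  fix x
  have lin: "linear w" and ip: "\<And>x y. w x \<bullet> w y = x \<bullet> y"
    using assms by (auto simp: orthogonal_transformation_def)
  obtain z where z: "x = w z" using orthogonal_transformation_surj[OF assms] by (meson surjD)
  have "inv w x = z" using z orthogonal_transformation_inj[OF assms] by simp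
  then show "(w \<circ> reflection_along a \<circ> inv w) x = reflection_along (w a) x"
    using z by (simp add: reflection_along_def linear_diff[OF lin] linear_cmul[OF lin] ip)
qed

lemma linear_functional_inner:
  fixes \<phi> :: "'a::euclidean_space \<Rightarrow> real"
  assumes "linear \<phi>" shows "\<phi> x = adjoint \<phi> 1 \<bullet> x"
  using adjoint_works[OF assms, of x 1] by (simp add: inner_commute)

text \<open>The scaling of \<phi> cancels against that of its coroot, so the formula defining
  \<open>pos_root\<close> is the reflection along the Riesz vector, whatever the root
  length.\<close>

lemma coroot_reflection:
  fixes \<phi> :: "'a::euclidean_space \<Rightarrow> real"
  assumes "linear \<phi>"
  shows "x - \<phi> x *\<^sub>R coroot \<phi> = reflection_along (adjoint \<phi> 1) x"
  using linear_functional_inner[OF assms, of x]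
  by (simp add: coroot_def Let_def reflection_along_def mult.commute)

section \<open>Words and their lengths\<close>

lemma word_prod_Nil [simp]: "word_prod [] = id"
  by (simp add: word_prod_def)

lemma word_prod_Cons [simp]: "word_prod (w # ws) = w \<circ> word_prod ws"
  by (simp add: word_prod_def)

lemma word_prod_append: "word_prod (xs @ ys) = word_prod xs \<circ> word_prod ys"
  by (induction xs) (auto simp: comp_assoc)

lemma word_length_le: "set ws \<subseteq> X \<Longrightarrow> word_length X (word_prod ws) \<le> length ws"
  unfolding word_length_def by (rule Least_le) blast

text \<open>The \<open>LEAST\<close> in \<open>word_length\<close> is attained only once some word
  for \<open>w\<close> is known to exist.\<close>

lemma word_length_witness:
  assumes "set ws \<subseteq> X" "word_prod ws = w"
  obtains ws' where "set ws' \<subseteq> X" "word_prod ws' = w" "length ws' = word_length X w"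
proof -
  let ?P = "\<lambda>k. \<exists>ws. set ws \<subseteq> X \<and> length ws = k \<and> word_prod ws = w"
  have "?P (length ws)" using assms by blast
  then have "?P (word_length X w)" unfolding word_length_def by (rule LeastI)
  then show thesis using that by blast
qed

text \<open>Each of \<open>n\<close> strict steps gains at least 1 and the total gain is
  \<open>n\<close>, so no step gains more. Here \<open>lower\<close> counts from the start up to
  \<open>i\<close>, and \<open>upper\<close> counts back from the end down to
  \<open>Suc i\<close>.\<close>

lemma unit_steps_of_total:
  fixes f :: "nat \<Rightarrow> nat"
  assumes "\<And>i. i < n \<Longrightarrow> f i < f (Suc i)" "f n = f 0 + n" "i < n"
  shows "f (Suc i) = f i + 1"
proof -
  have lower: "f 0 + j \<le> f j" if "j \<le> n" for j
    using that
  proof (induction j)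
    case (Suc j)
    then show ?case using assms(1)[of j] by simp
  qed simp
  have upper: "f (n - j) + j \<le> f n" if "j \<le> n" for j
    using that
  proof (induction j)
    case (Suc j)
    then show ?case using assms(1)[of "n - Suc j"] by (simp add: Suc_diff_Suc)
  qed simp
  show ?thesis
    using lower[of i] upper[of "n - Suc i"] assms(1)[OF assms(3)] assms(2,3) by simp
qed

text \<open>A family is used instead of a set because the vectors of a chain are not known in
  advance to be distinct. Spanning with only \<open>DIM('a)\<close> members forces \<open>d\<close>
  to be injective with independent image.\<close>

lemma spanning_family_coefficients_unique:
  fixes d :: "'i \<Rightarrow> 'a::euclidean_space"
  assumes "finite I" "card I = DIM('a)" "span (d ` I) = UNIV"
    and "(\<Sum>i\<in>I. a i *\<^sub>R d i) = (\<Sum>i\<in>I. b i *\<^sub>R d i)" "i \<in> I"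
  shows "a i = b i"
proof -
  have "DIM('a) \<le> card (d ` I)"
    using dim_le_card[of UNIV "d ` I"] assms(1,3) by simp
  then have card: "card (d ` I) = card I"
    using card_image_le[OF assms(1), of d] assms(2) by linarith
  then have inj: "inj_on d I" using assms(1) by (simp add: eq_card_imp_inj_on)
  have indep: "independent (d ` I)"
    using card assms(1-3) by (subst card_eq_dim[of _ UNIV]) auto
  \<comment> \<open>Coefficients are moved from indices to vectors, since independence speaks about
    sums over a set of vectors.\<close>
  have "(\<Sum>v\<in>d ` I. (a (inv_into I d v) - b (inv_into I d v)) *\<^sub>R v) = (\<Sum>i\<in>I. (a i - b i) *\<^sub>R d i)"
    using inj by (subst sum.reindex) (auto intro!: sum.cong)
  also have "\<dots> = 0" using assms(4) by (simp add: scaleR_diff_left sum_subtractf)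
  finally have "a (inv_into I d (d i)) - b (inv_into I d (d i)) = 0"
    using independentD[OF indep _ subset_refl,
        of "\<lambda>v. a (inv_into I d v) - b (inv_into I d v)" "d i"] assms(1,5) by simp
  then show ?thesis using inj assms(5) by simp
qed

subsection \<open>Reflection groups and chambers\<close>

locale coxeter_chamber =
  fixes W :: "('a::euclidean_space \<Rightarrow> 'a) set" and B :: "'a set"
  assumes cox: "finite_coxeter_group W" and base: "base_region W B"
begin

abbreviation "T \<equiv> reflections W"
abbreviation "S \<equiv> simple_reflections W B"

lemma finite_W: "finite W"
  and id_in_W: "id \<in> W"
  and comp_in_W: "v \<in> W \<Longrightarrow> w \<in> W \<Longrightarrow> v \<circ> w \<in> W"
  and inv_in_W: "w \<in> W \<Longrightarrow> inv w \<in> W"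
  and orth_W: "w \<in> W \<Longrightarrow> orthogonal_transformation w"
  and T_generates: "w \<in> W \<Longrightarrow> \<exists>ts. set ts \<subseteq> T \<and> word_prod ts = w"
  and essential: "(\<And>w. w \<in> W \<Longrightarrow> w x = x) \<Longrightarrow> x = 0"
  using cox unfolding finite_coxeter_group_def by blast+

lemma bij_W: "w \<in> W \<Longrightarrow> bij w"
  by (simp add: bij_def orth_W orthogonal_transformation_inj orthogonal_transformation_surj)

lemma linear_W: "w \<in> W \<Longrightarrow> linear w"
  by (simp add: orth_W orthogonal_transformation_linear)

lemma W_inverse [simp]:
  assumes "w \<in> W"
  shows "w (inv w x) = x" "inv w (w x) = x" "w \<circ> inv w = id" "inv w \<circ> w = id" "inv (inv w) = w"
  using bij_W[OF assms] by (auto simp: bij_def surj_f_inv_f fun_eq_iff inv_inv_eq)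

lemma inv_comp_W: "v \<in> W \<Longrightarrow> w \<in> W \<Longrightarrow> inv (v \<circ> w) = inv w \<circ> inv v"
  by (simp add: bij_W o_inv_distrib)

lemma inner_W: "w \<in> W \<Longrightarrow> w x \<bullet> w y = x \<bullet> y"
  using orth_W by (auto simp: orthogonal_transformation_def)

lemma inner_inv_W: "w \<in> W \<Longrightarrow> x \<bullet> inv w y = w x \<bullet> y"
  by (metis W_inverse(1) inner_W)

lemma T_subset_W: "t \<in> T \<Longrightarrow> t \<in> W"
  by (simp add: reflections_def)

lemma finite_T: "finite T"
  using finite_W by (simp add: reflections_def)

lemma S_subset_T: "S \<subseteq> T"
  by (auto simp: simple_reflections_def)

lemma S_subset_W: "s \<in> S \<Longrightarrow> s \<in> W"
  using S_subset_T T_subset_W by blast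

lemma word_prod_in_W: "set ws \<subseteq> W \<Longrightarrow> word_prod ws \<in> W"
  by (induction ws) (auto simp: id_in_W comp_in_W)

lemma T_involution:
  assumes "t \<in> T" shows "t (t x) = x" "t \<circ> t = id" "inv t = t"
proof -
  show *: "t (t x) = x" for x
    using assms reflection_along_involution by (auto simp: reflections_def is_reflection_iff)
  then show "t \<circ> t = id" by auto
  then show "inv t = t" by (simp add: inv_unique_comp)
qed

section \<open>The base region and its unit normals\<close>

lemma B_nonempty: "B \<noteq> {}"
  and B_connected: "connected B"
  and B_disjoint: "y \<in> B \<Longrightarrow> t \<in> T \<Longrightarrow> t y \<noteq> y"
  using base in_components_nonempty in_components_connected in_components_subset
  unfolding base_region_def by (blast, blast, fastforce simp: hyperplanes_def fixed_space_def)

definition y0 :: 'a where "y0 = (SOME y. y \<in> B)"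

lemma y0_in_B: "y0 \<in> B"
  using B_nonempty by (simp add: y0_def some_in_eq)

text \<open>The unit normal of the hyperplane of \<open>t\<close> on the side of the base region. It
  stands in for the positive root without depending on \<Phi>; \<open>pos_root\<close> is a positive
  multiple of the pairing with it.\<close>

definition normal :: "('a \<Rightarrow> 'a) \<Rightarrow> 'a" where
  "normal t = (SOME a. norm a = 1 \<and> reflection_along a = t \<and> a \<bullet> y0 > 0)"

lemma normal:
  assumes "t \<in> T"
  shows norm_normal: "norm (normal t) = 1"
    and reflection_normal: "reflection_along (normal t) = t"
    and normal_y0: "normal t \<bullet> y0 > 0"
proof -
  obtain a where a: "a \<noteq> 0" "reflection_along a = t"
    using assms by (auto simp: reflections_def is_reflection_iff)
  define b where "b = (1 / norm a) *\<^sub>R a"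
  have b: "norm b = 1" "reflection_along b = t"
    using a reflection_along_scaleR[of "1 / norm a" a] by (auto simp: b_def)
  then have "b \<bullet> y0 \<noteq> 0"
    using B_disjoint[OF y0_in_B assms] by (auto simp: reflection_along_def)
  then have "b \<bullet> y0 > 0 \<or> - b \<bullet> y0 > 0" by auto
  moreover have "norm (- b) = 1" "reflection_along (- b) = t"
    using b reflection_along_minus[of b] by auto
  ultimately have "\<exists>a. norm a = 1 \<and> reflection_along a = t \<and> a \<bullet> y0 > 0" using b by blast
  from someI_ex[OF this] show "norm (normal t) = 1" "reflection_along (normal t) = t"
      "normal t \<bullet> y0 > 0"
    by (simp_all add: normal_def)
qed

lemma normal_nonzero: "t \<in> T \<Longrightarrow> normal t \<noteq> 0"
  using norm_normal by fastforce

lemma T_apply: "t \<in> T \<Longrightarrow> t x = x - (2 * (normal t \<bullet> x)) *\<^sub>R normal t"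
  using reflection_normal[of t] norm_normal[of t]
  by (metis (no_types, lifting) div_by_1 norm_eq_1 reflection_along_def)

lemma T_self_adjoint: "t \<in> T \<Longrightarrow> x \<bullet> t y = t x \<bullet> y"
  using reflection_normal inner_reflection_along by metis

lemma fixed_space_T: "t \<in> T \<Longrightarrow> fixed_space t = {x. normal t \<bullet> x = 0}"
  by (metis fixed_space_reflection_along normal_nonzero reflection_normal)

lemma T_fixes_iff: "t \<in> T \<Longrightarrow> t x = x \<longleftrightarrow> normal t \<bullet> x = 0"
  using fixed_space_T by (auto simp: fixed_space_def)

text \<open>A nonpositive value somewhere on the connected set \<open>B\<close>, against the
  positive value at \<open>y0\<close>, would yield a point of \<open>B\<close> on the hyperplane of
  \<open>t\<close>.\<close>

lemma normal_pos:
  assumes "t \<in> T" "y \<in> B" shows "normal t \<bullet> y > 0"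
proof (rule ccontr)
  assume "\<not> ?thesis"
  then obtain z where "z \<in> B" "normal t \<bullet> z = 0"
    using connected_ivt_hyperplane[OF B_connected assms(2) y0_in_B, of "normal t" 0]
      normal_y0[OF assms(1)] by force
  then show False using B_disjoint assms(1) T_fixes_iff by blast
qed

text \<open>The intersection of the open half-spaces is convex, avoids all hyperplanes and meets
  \<open>B\<close>, so maximality of a component places it inside \<open>B\<close>.\<close>

lemma mem_B_iff: "y \<in> B \<longleftrightarrow> (\<forall>t\<in>T. normal t \<bullet> y > 0)"
proof -
  let ?C = "{y. \<forall>t\<in>T. normal t \<bullet> y > 0}"
  have C: "?C = (\<Inter>t\<in>T. {y. normal t \<bullet> y > 0})" by auto
  have "convex ?C" unfolding C by (intro convex_INT convex_halfspace_gt)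
  moreover have "?C \<subseteq> UNIV - \<Union> (hyperplanes W)"
    by (auto simp: hyperplanes_def fixed_space_T)
  moreover have "B \<inter> ?C \<noteq> {}" using y0_in_B normal_y0 by blast
  ultimately have "?C \<subseteq> B"
    using components_maximal base convex_connected unfolding base_region_def by meson
  then show ?thesis using normal_pos by blast
qed

lemma open_B: "open B"
proof -
  have "open (\<Inter>t\<in>T. {y. normal t \<bullet> y > 0})"
    using finite_T by (intro open_INT ballI open_halfspace_gt)
  moreover have "(\<Inter>t\<in>T. {y. normal t \<bullet> y > 0}) = B" using mem_B_iff by blast
  ultimately show ?thesis by simp
qed

lemma closure_B: "closure B = {y. \<forall>t\<in>T. normal t \<bullet> y \<ge> 0}"
proof
  have "{y. \<forall>t\<in>T. normal t \<bullet> y \<ge> 0} = (\<Inter>t\<in>T. {y. normal t \<bullet> y \<ge> 0})" by auto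
  then have "closed {y. \<forall>t\<in>T. normal t \<bullet> y \<ge> 0}"
    by (simp add: closed_INT closed_halfspace_ge)
  then show "closure B \<subseteq> {y. \<forall>t\<in>T. normal t \<bullet> y \<ge> 0}"
    using normal_pos by (intro closure_minimal) (auto intro: less_imp_le)
  show "{y. \<forall>t\<in>T. normal t \<bullet> y \<ge> 0} \<subseteq> closure B"
  proof
    fix y assume y: "y \<in> {y. \<forall>t\<in>T. normal t \<bullet> y \<ge> 0}"
    \<comment> \<open>A small multiple of \<open>y0\<close> pushes \<open>y\<close> into the open
      region.\<close>
    have "y + (1 / real (Suc n)) *\<^sub>R y0 \<in> B" for n
      using y normal_y0 by (auto simp: mem_B_iff inner_add_right intro!: add_nonneg_pos)
    moreover have "(\<lambda>n. y + (1 / real (Suc n)) *\<^sub>R y0) \<longlonglongrightarrow> y + 0 *\<^sub>R y0"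
      by (intro tendsto_intros LIMSEQ_Suc[OF lim_1_over_n])
    ultimately show "y \<in> closure B" unfolding closure_sequential by fastforce
  qed
qed

lemma normal_inj:
  assumes "t \<in> T" "t' \<in> T" "normal t = k *\<^sub>R normal t'" shows "t = t'"
  using assms reflection_along_scaleR[of k "normal t'"] reflection_normal normal_nonzero
  by (metis scaleR_zero_left)

lemma conj_in_T:
  assumes "w \<in> W" "t \<in> T"
  shows "w \<circ> t \<circ> inv w \<in> T"
    and "w (normal t) = normal (w \<circ> t \<circ> inv w) \<or> w (normal t) = - normal (w \<circ> t \<circ> inv w)"
proof -
  have eq: "w \<circ> t \<circ> inv w = reflection_along (w (normal t))"
    using reflection_along_conj[OF orth_W[OF assms(1)]] reflection_normal[OF assms(2)] by metis
  have n1: "norm (w (normal t)) = 1"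
    using orth_W[OF assms(1)] assms(2) by (simp add: orthogonal_transformation_norm norm_normal)
  then have "w (normal t) \<noteq> 0" by auto
  moreover have "w \<circ> t \<circ> inv w \<in> W"
    using assms by (simp add: T_subset_W comp_in_W inv_in_W)
  ultimately show T: "w \<circ> t \<circ> inv w \<in> T"
    using eq unfolding reflections_def is_reflection_iff by blast
  show "w (normal t) = normal (w \<circ> t \<circ> inv w) \<or> w (normal t) = - normal (w \<circ> t \<circ> inv w)"
    using reflection_along_unit_eq[OF _ n1 norm_normal[OF T]] eq reflection_normal[OF T] by metis
qed

text \<open>No hyperplane cuts a translate of \<open>B\<close>. Moving \<open>w\<close> across the
  pairing replaces \<open>normal t\<close> by plus or minus another normal, which has constant sign
  on \<open>B\<close>.\<close>

lemma sign_on_translate: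
  assumes "w \<in> W" "t \<in> T" "y \<in> B"
  shows "normal t \<bullet> inv w y \<noteq> 0" and "normal t \<bullet> inv w y > 0 \<longleftrightarrow> normal t \<bullet> inv w y0 > 0"
proof -
  have "w (normal t) \<bullet> z > 0" if "w (normal t) = normal (w \<circ> t \<circ> inv w)" "z \<in> B" for z
    using that normal_pos conj_in_T(1)[OF assms(1,2)] by simp
  moreover have "w (normal t) \<bullet> z < 0" if "w (normal t) = - normal (w \<circ> t \<circ> inv w)" "z \<in> B" for z
    using that normal_pos conj_in_T(1)[OF assms(1,2)] by simp
  ultimately have "(\<forall>z\<in>B. w (normal t) \<bullet> z > 0) \<or> (\<forall>z\<in>B. w (normal t) \<bullet> z < 0)"
    using conj_in_T(2)[OF assms(1,2)] by blast
  then show "normal t \<bullet> inv w y \<noteq> 0" and "normal t \<bullet> inv w y > 0 \<longleftrightarrow> normal t \<bullet> inv w y0 > 0"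
    using assms(3) y0_in_B unfolding inner_inv_W[OF assms(1)] by force+
qed

section \<open>Walls and simple reflections\<close>

text \<open>Produces a point of the wall of \<open>s\<close> that lies strictly on the positive side
  of all other hyperplanes. It separates \<open>s\<close> from the other reflections in all sign
  arguments below.\<close>

lemma facet_point:
  assumes "s \<in> S"
  obtains p where "normal s \<bullet> p = 0" "\<And>t. t \<in> T \<Longrightarrow> t \<noteq> s \<Longrightarrow> normal t \<bullet> p > 0"
proof -
  have sT: "s \<in> T" using assms S_subset_T by blast
  define F where "F = {x. normal s \<bullet> x = 0} \<inter> closure B"
  have "F facet_of closure B"
    using assms by (simp add: F_def simple_reflections_def walls_def fixed_space_T[OF sT])
  then have Fne: "F \<noteq> {}" and Fdim: "aff_dim F = int DIM('a) - 1"
    using aff_dim_open[OF open_B B_nonempty] aff_dim_affine_hull[of "closure B"] aff_dim_affine_hull[of B]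
    by (auto simp: facet_of_def)
  have ex: "\<exists>p\<in>F. normal t \<bullet> p > 0" if t: "t \<in> T" "t \<noteq> s" for t
  proof (rule ccontr)
    assume "\<not> ?thesis"
    then have "normal t \<bullet> x \<le> 0" if "x \<in> F" for x using that by (meson not_less)
    moreover have "normal t \<bullet> x \<ge> 0" if "x \<in> F" for x
      using that t(1) closure_B unfolding F_def by blast
    ultimately have sub: "F \<subseteq> {x. normal t \<bullet> x = 0}" by (auto intro: antisym)
    \<comment> \<open>The facet has codimension 1, so it affinely spans the hyperplane of
      \<open>s\<close>; lying in the hyperplane of \<open>t\<close> too, it would force the two
      hyperplanes to coincide.\<close>
    have "affine hull F = {x. normal s \<bullet> x = 0}"
    proof (rule affine_dim_equal)
      show "affine hull F \<subseteq> {x. normal s \<bullet> x = 0}"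
        by (rule hull_minimal) (auto simp: F_def affine_hyperplane)
      show "aff_dim (affine hull F) = aff_dim {x. normal s \<bullet> x = 0}"
        using Fdim aff_dim_hyperplane[OF normal_nonzero[OF sT]] by simp
    qed (use Fne affine_hyperplane in auto)
    moreover have "affine hull F \<subseteq> {x. normal t \<bullet> x = 0}"
      using sub by (rule hull_minimal) (simp add: affine_hyperplane)
    ultimately have HH: "normal t \<bullet> x = 0" if "normal s \<bullet> x = 0" for x
      using that by blast
    \<comment> \<open>The component of \<open>normal t\<close> orthogonal to
      \<open>normal s\<close>: it lies in both hyperplanes and is therefore orthogonal to
      itself.\<close>
    define d where "d = normal t - (normal s \<bullet> normal t) *\<^sub>R normal s"
    have "normal s \<bullet> d = 0"
      using norm_normal[OF sT] by (simp add: d_def inner_diff_right norm_eq_1)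
    then have "d \<bullet> d = 0" using HH[of d] by (simp add: d_def inner_diff_left)
    then have "normal t = (normal s \<bullet> normal t) *\<^sub>R normal s" by (simp add: d_def)
    then show False using normal_inj[OF t(1) sT] t(2) by blast
  qed
  then obtain q where q: "\<And>t. t \<in> T \<Longrightarrow> t \<noteq> s \<Longrightarrow> q t \<in> F \<and> normal t \<bullet> q t > 0"
    by metis
  show thesis
  proof
    \<comment> \<open>The summands lie in the closed cone, so in the pairing with
      \<open>normal t\<close> the positive contribution of \<open>q t\<close> cannot be
      cancelled.\<close>
    show "normal s \<bullet> (\<Sum>t\<in>T - {s}. q t) = 0"
      using q by (auto simp: inner_sum_right F_def intro!: sum.neutral)
    fix t assume t: "t \<in> T" "t \<noteq> s"
    then show "normal t \<bullet> (\<Sum>t\<in>T - {s}. q t) > 0"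
      unfolding inner_sum_right using finite_T q closure_B
      by (intro sum_pos2[of _ t]) (auto simp: F_def)
  qed
qed

text \<open>The closed region is a polyhedron. In a smallest family of half-spaces cutting it out,
  each member bounds a facet, so its reflection is simple.\<close>

lemma closure_B_simple:
  assumes "\<And>s. s \<in> S \<Longrightarrow> normal s \<bullet> x \<ge> 0"
  shows "x \<in> closure B"
proof -
  \<comment> \<open>The sign is chosen to match the form \<open>a \<bullet> x \<le> b\<close> used
    for polyhedra.\<close>
  define h where "h t = {x. - normal t \<bullet> x \<le> 0}" for t
  define P where "P F \<longleftrightarrow> F \<subseteq> h ` T \<and> \<Inter>F = closure B" for F
  have "P (h ` T)" by (auto simp: closure_B h_def P_def)
  then obtain F where PF: "P F" and min: "\<And>F'. P F' \<Longrightarrow> card F \<le> card F'"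
    using ex_has_least_nat[of P "h ` T" card] by blast
  then have F: "F \<subseteq> h ` T" "\<Inter>F = closure B" by (simp_all add: P_def)
  have finF: "finite F" using F(1) finite_T finite_subset by blast
  define g where "g H = (SOME t. t \<in> T \<and> h t = H)" for H
  have g: "g H \<in> T" "h (g H) = H" if "H \<in> F" for H
    using someI_ex[of "\<lambda>t. t \<in> T \<and> h t = H"] that F(1) by (auto simp: g_def)
  have hull: "affine hull (closure B) = UNIV"
    using affine_hull_open[OF open_B B_nonempty] by simp
  have facets: "C facet_of closure B \<longleftrightarrow>
      (\<exists>H. H \<in> F \<and> C = closure B \<inter> {x. - normal (g H) \<bullet> x = 0})" for C
  proof (rule facet_of_polyhedron_explicit)
    show "finite F" by (rule finF)
    show "closure B = affine hull closure B \<inter> \<Inter> F" using hull F(2) by simp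
    show "- normal (g H) \<noteq> 0 \<and> H = {x. - normal (g H) \<bullet> x \<le> 0}" if "H \<in> F" for H
      using g[OF that] normal_nonzero unfolding h_def by auto
    \<comment> \<open>Minimal cardinality gives irredundancy: a proper subfamily cuts out a strictly
      larger set.\<close>
    fix F' assume F': "F' \<subset> F"
    then have "\<not> P F'" using min[of F'] psubset_card_mono[OF finF F'] by linarith
    then have "\<Inter>F' \<noteq> closure B" using F' F(1) by (auto simp: P_def)
    moreover have "\<Inter>F \<subseteq> \<Inter>F'" using F' by blast
    ultimately show "closure B \<subset> affine hull closure B \<inter> \<Inter> F'" using hull F(2) by auto
  qed
  have "x \<in> H" if "H \<in> F" for H
  proof -
    have gT: "g H \<in> T" using g[OF that] by blast
    have "closure B \<inter> {x. - normal (g H) \<bullet> x = 0} facet_of closure B"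
      using facets that by blast
    then have "g H \<in> S"
      using gT by (simp add: simple_reflections_def walls_def hyperplanes_def fixed_space_T Int_commute)
    then have "x \<in> h (g H)" using assms by (simp add: h_def)
    then show ?thesis using g[OF that] by simp
  qed
  then show ?thesis using F(2) by blast
qed

text \<open>A simple reflection permutes the normals other than its own without changing signs. It
  fixes the facet point \<open>p\<close>, at which both \<open>s (normal t)\<close> and the normal
  of the conjugate are positive, and this rules out the minus sign.\<close>

lemma simple_conj_normal:
  assumes "s \<in> S" "t \<in> T" "t \<noteq> s"
  shows "s (normal t) = normal (s \<circ> t \<circ> s)"
proof -
  have sT: "s \<in> T" and sW: "s \<in> W" using assms S_subset_T T_subset_W by blast+
  obtain p where p: "normal s \<bullet> p = 0" "\<And>t. t \<in> T \<Longrightarrow> t \<noteq> s \<Longrightarrow> normal t \<bullet> p > 0"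
    using facet_point[OF assms(1)] by blast
  have inv: "inv s = s" and ss: "s \<circ> s = id" using T_involution[OF sT] by auto
  have st: "s \<circ> t \<circ> s \<in> T" using conj_in_T[OF sW assms(2)] inv by simp
  have ne: "s \<circ> t \<circ> s \<noteq> s"
  proof
    assume "s \<circ> t \<circ> s = s"
    then have "s \<circ> (s \<circ> t \<circ> s) \<circ> s = s \<circ> s \<circ> s" by simp
    then have "(s \<circ> s) \<circ> t \<circ> (s \<circ> s) = s \<circ> s \<circ> s" by (simp only: comp_assoc)
    then show False using ss assms(3) by simp
  qed
  have "s (normal t) \<bullet> p = normal t \<bullet> p"
    using T_self_adjoint[OF sT] T_fixes_iff[OF sT] p(1) by metis
  then have "s (normal t) \<bullet> p > 0" using p(2) assms by simp
  moreover have "normal (s \<circ> t \<circ> s) \<bullet> p > 0" using p(2)[OF st ne] .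
  ultimately show ?thesis using conj_in_T(2)[OF sW assms(2)] inv by fastforce
qed

text \<open>
  A positive normal has positive inner product with some simple normal, and reflecting in the latter
  lowers the height \<open>normal t \<bullet> y0\<close>.
\<close>

lemma T_word_in_S:
  assumes "t \<in> T" shows "\<exists>ws. set ws \<subseteq> S \<and> word_prod ws = t"
  using assms
\<comment> \<open>Heights are real numbers, so the induction is on the finite number of reflections
  of smaller height.\<close>
proof (induction "card {t' \<in> T. normal t' \<bullet> y0 < normal t \<bullet> y0}" arbitrary: t rule: less_induct)
  case less
  have "\<exists>s\<in>S. normal s \<bullet> normal t > 0"
  proof (rule ccontr)
    assume "\<not> ?thesis"
    \<comment> \<open>If no simple normal pairs positively with \<open>normal t\<close>, the
      opposite vector satisfies all simple inequalities, yet it is negative on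
      \<open>normal t\<close>.\<close>
    then have "- normal t \<in> closure B" by (intro closure_B_simple) force
    then have "normal t \<bullet> - normal t \<ge> 0" using less.prems closure_B by blast
    then show False using norm_normal[OF less.prems] by (simp add: norm_eq_1)
  qed
  then obtain s where s: "s \<in> S" "normal s \<bullet> normal t > 0" by blast
  then have sT: "s \<in> T" using S_subset_T by blast
  show ?case
  proof (cases "t = s")
    case True
    then show ?thesis using s by (intro exI[of _ "[s]"]) auto
  next
    case False
    let ?t = "s \<circ> t \<circ> s"
    have tT: "?t \<in> T"
      using conj_in_T(1)[OF T_subset_W[OF sT] less.prems] T_involution(3)[OF sT] by simp
    have "normal ?t = normal t - (2 * (normal s \<bullet> normal t)) *\<^sub>R normal s"
      using simple_conj_normal[OF s(1) less.prems False] T_apply[OF sT] by simp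
    then have "normal ?t \<bullet> y0 < normal t \<bullet> y0"
      using s(2) normal_y0[OF sT] by (simp add: inner_diff_left)
    then have "card {t' \<in> T. normal t' \<bullet> y0 < normal ?t \<bullet> y0}
        < card {t' \<in> T. normal t' \<bullet> y0 < normal t \<bullet> y0}"
      using finite_T tT by (intro psubset_card_mono) auto
    then obtain ws where ws: "set ws \<subseteq> S" "word_prod ws = ?t"
      using less.hyps tT by blast
    have "word_prod (s # ws @ [s]) = (s \<circ> s) \<circ> t \<circ> (s \<circ> s)"
      using ws(2) by (simp add: word_prod_append comp_assoc)
    then have "word_prod (s # ws @ [s]) = t" using T_involution(2)[OF sT] by simp
    moreover have "set (s # ws @ [s]) \<subseteq> S" using ws(1) s(1) by simp
    ultimately show ?thesis by blast
  qed
qed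

lemma W_word_in_S:
  assumes "w \<in> W" shows "\<exists>ws. set ws \<subseteq> S \<and> word_prod ws = w"
proof -
  have "\<exists>ws. set ws \<subseteq> S \<and> word_prod ws = word_prod ts" if "set ts \<subseteq> T" for ts
    using that
  proof (induction ts)
    case Nil
    then show ?case by (intro exI[of _ "[]"]) auto
  next
    case (Cons t ts)
    then obtain xs ys where "set xs \<subseteq> S" "word_prod xs = t" "set ys \<subseteq> S" "word_prod ys = word_prod ts"
      using T_word_in_S by (metis insert_subset list.simps(15))
    then show ?case by (intro exI[of _ "xs @ ys"]) (auto simp: word_prod_append)
  qed
  then show ?thesis using T_generates[OF assms] by blast
qed

subsection \<open>Lengths and exchange\<close>

text \<open>The letters are stripped from the left until the one that makes the pairing with
  \<open>normal t\<close> negative is reached. Multiplying by \<open>t\<close> on the right deletes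
  that letter.\<close>

lemma strong_exchange:
  assumes "set ws \<subseteq> S" "t \<in> T" "normal t \<bullet> inv (word_prod ws) y0 < 0"
  shows "\<exists>ws'. set ws' \<subseteq> S \<and> length ws' < length ws \<and> word_prod ws' = word_prod ws \<circ> t"
  using assms(1,3)
proof (induction ws)
  case Nil
  then show ?case using normal_y0[OF assms(2)] by (simp add: inv_id[unfolded id_def] id_def)
next
  case (Cons s ws)
  define v where "v = word_prod ws"
  have s: "s \<in> S" "s \<in> T" and ws: "set ws \<subseteq> S" using Cons.prems S_subset_T by auto
  have vW: "v \<in> W" unfolding v_def using ws S_subset_W by (intro word_prod_in_W) blast
  show ?case
  proof (cases "normal t \<bullet> inv v y0 < 0")
    case True
    then obtain ws' where "set ws' \<subseteq> S" "length ws' < length ws" "word_prod ws' = v \<circ> t"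
      using Cons.IH ws v_def by blast
    then show ?thesis using s(1) by (intro exI[of _ "s # ws'"]) (auto simp: v_def comp_assoc)
  next
    case False
    let ?t = "v \<circ> t \<circ> inv v"
    have tT: "?t \<in> T" using conj_in_T(1)[OF vW assms(2)] .
    have "v (normal t) \<bullet> y0 \<ge> 0" using False inner_inv_W[OF vW] by simp
    then have eq: "v (normal t) = normal ?t"
      using conj_in_T(2)[OF vW assms(2)] normal_y0[OF tT] by auto
    have "inv (word_prod (s # ws)) y0 = inv v (s y0)"
      using inv_comp_W[OF T_subset_W[OF s(2)] vW] T_involution(3)[OF s(2)] by (simp add: v_def)
    then have neg: "s (normal ?t) \<bullet> y0 < 0"
      using Cons.prems(2) inner_inv_W[OF vW] eq T_self_adjoint[OF s(2)] by metis
    \<comment> \<open>The tail still sends \<open>normal t\<close> to a positive normal and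
      \<open>s\<close> makes it negative; the only positive normal that \<open>s\<close> makes
      negative is its own.\<close>
    have "?t = s"
    proof (rule ccontr)
      assume ne: "?t \<noteq> s"
      have "s \<circ> ?t \<circ> s \<in> T"
        using conj_in_T(1)[OF T_subset_W[OF s(2)] tT] T_involution(3)[OF s(2)] by simp
      then show False using normal_y0 simple_conj_normal[OF s(1) tT ne] neg by force
    qed
    have "s \<circ> v \<circ> t = s \<circ> ?t \<circ> v"
      using vW by (simp add: fun_eq_iff)
    also have "\<dots> = v" using \<open>?t = s\<close> T_involution(2)[OF s(2)] by simp
    finally have "word_prod ws = word_prod (s # ws) \<circ> t" by (simp add: v_def)
    then show ?thesis using ws by (metis length_Cons lessI)
  qed
qed

lemma length_S_comp_less:
  assumes "v \<in> W" "t \<in> T" "normal t \<bullet> inv v y0 < 0"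
  shows "length_S W B (v \<circ> t) < length_S W B v"
proof -
  obtain ws where ws: "set ws \<subseteq> S" "word_prod ws = v" "length ws = length_S W B v"
    using word_length_witness W_word_in_S[OF assms(1)] by metis
  then obtain ws' where "set ws' \<subseteq> S" "length ws' < length ws" "word_prod ws' = v \<circ> t"
    using strong_exchange[OF ws(1) assms(2)] assms(3) by auto
  then show ?thesis using word_length_le[of ws' S] ws(3) by simp
qed

text \<open>One direction is the decrease lemma together with nonvanishing of the pairing. For the
  other, the decrease lemma is applied to \<open>v \<circ> t\<close>, where the sign is reversed,
  and multiplication by \<open>t\<close> leads back to \<open>v\<close>.\<close>

lemma length_S_increases_iff:
  assumes "v \<in> W" "t \<in> T"
  shows "length_S W B v < length_S W B (v \<circ> t) \<longleftrightarrow> normal t \<bullet> inv v y0 > 0"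
proof
  assume "length_S W B v < length_S W B (v \<circ> t)"
  then show "normal t \<bullet> inv v y0 > 0"
    using length_S_comp_less[OF assms] sign_on_translate(1)[OF assms y0_in_B] by linarith
next
  assume pos: "normal t \<bullet> inv v y0 > 0"
  have "inv (v \<circ> t) y0 = t (inv v y0)"
    using inv_comp_W[OF assms(1) T_subset_W[OF assms(2)]] T_involution(3)[OF assms(2)] by simp
  moreover have "t (normal t) = - normal t"
    using reflection_along_self[OF normal_nonzero[OF assms(2)]] reflection_normal[OF assms(2)] by simp
  ultimately have "normal t \<bullet> inv (v \<circ> t) y0 < 0"
    using pos T_self_adjoint[OF assms(2)] by simp
  then have "length_S W B ((v \<circ> t) \<circ> t) < length_S W B (v \<circ> t)"
    using assms T_subset_W comp_in_W by (intro length_S_comp_less) auto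
  then show "length_S W B v < length_S W B (v \<circ> t)"
    using T_involution(2)[OF assms(2)] by (simp add: comp_assoc)
qed

subsection \<open>Simple normals and Coxeter elements\<close>

text \<open>At a point \<open>p\<close> of the wall of \<open>s'\<close>, the normal of the
  conjugate takes the value
  \<open>-2 * (normal s \<bullet> normal s') * (normal s \<bullet> p)\<close>. This value is
  nonnegative, while \<open>normal s \<bullet> p\<close> is positive.\<close>

lemma simple_normals_obtuse:
  assumes "s \<in> S" "s' \<in> S" "s \<noteq> s'" shows "normal s \<bullet> normal s' \<le> 0"
proof -
  have T: "s \<in> T" "s' \<in> T" using assms S_subset_T by auto
  obtain p where p: "normal s' \<bullet> p = 0" "\<And>t. t \<in> T \<Longrightarrow> t \<noteq> s' \<Longrightarrow> normal t \<bullet> p > 0"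
    using facet_point[OF assms(2)] by blast
  let ?t = "s \<circ> s' \<circ> s"
  have tT: "?t \<in> T"
    using conj_in_T(1)[OF T_subset_W[OF T(1)] T(2)] T_involution(3)[OF T(1)] by simp
  have "normal ?t = normal s' - (2 * (normal s \<bullet> normal s')) *\<^sub>R normal s"
    using simple_conj_normal[OF assms(1) T(2)] assms(3) T_apply[OF T(1)] by simp
  moreover have "normal ?t \<bullet> p \<ge> 0" using p tT by (metis less_eq_real_def)
  ultimately have "(normal s \<bullet> normal s') * (normal s \<bullet> p) \<le> 0"
    using p(1) by (simp add: inner_diff_left mult.commute)
  moreover have "normal s \<bullet> p > 0" using p(2) T assms(3) by blast
  ultimately show ?thesis by (simp add: mult_le_0_iff)
qed

lemma normal_inj_on_S: "inj_on normal S"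
  using normal_inj[of _ _ 1] S_subset_T by (auto simp: inj_on_def)

lemma finite_S: "finite S"
  using finite_T S_subset_T finite_subset by blast

text \<open>
  In a vanishing linear combination the positive and the negative part agree up to sign; obtuseness makes
  the common vector zero, and pairing with \<open>y0\<close> kills the coefficients.
\<close>

lemma simple_normals_independent: "independent (normal ` S)"
proof (rule independent_if_scalars_zero)
  show "finite (normal ` S)" using finite_S by simp
  fix f a assume sum0: "(\<Sum>x\<in>normal ` S. f x *\<^sub>R x) = 0" and a: "a \<in> normal ` S"
  define P where "P = {x \<in> normal ` S. f x > 0}"
  define N where "N = {x \<in> normal ` S. f x < 0}"
  have fin: "finite P" "finite N" using finite_S by (auto simp: P_def N_def)
  have pos: "x \<bullet> y0 > 0" if "x \<in> normal ` S" for x using that normal_y0 S_subset_T by blast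
  have "(\<Sum>x\<in>normal ` S. f x *\<^sub>R x) = (\<Sum>x\<in>P \<union> N. f x *\<^sub>R x)"
    using finite_S by (intro sum.mono_neutral_right) (auto simp: P_def N_def)
  also have "\<dots> = (\<Sum>x\<in>P. f x *\<^sub>R x) + (\<Sum>x\<in>N. f x *\<^sub>R x)"
    using fin by (intro sum.union_disjoint) (auto simp: P_def N_def)
  finally have eq: "(\<Sum>x\<in>P. f x *\<^sub>R x) = (\<Sum>x\<in>N. (- f x) *\<^sub>R x)"
    using sum0 by (simp add: sum_negf eq_neg_iff_add_eq_0)
  define v where "v = (\<Sum>x\<in>P. f x *\<^sub>R x)"
  have "v \<bullet> v = (\<Sum>x\<in>P. f x *\<^sub>R x) \<bullet> (\<Sum>x\<in>N. (- f x) *\<^sub>R x)"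
    using eq by (simp add: v_def)
  also have "\<dots> = (\<Sum>x\<in>P. \<Sum>z\<in>N. (f x * (- f z)) * (x \<bullet> z))"
    unfolding inner_sum_left unfolding inner_sum_right by (simp add: mult_ac)
  also have "\<dots> \<le> 0"
  proof (intro sum_nonpos)
    fix x z assume "x \<in> P" "z \<in> N"
    moreover then have "x \<bullet> z \<le> 0"
      using simple_normals_obtuse by (force simp: P_def N_def)
    ultimately show "(f x * (- f z)) * (x \<bullet> z) \<le> 0"
      by (intro mult_nonneg_nonpos mult_nonneg_nonneg) (auto simp: P_def N_def)
  qed
  finally have v0: "v = 0" using inner_gt_zero_iff[of v] by linarith
  have "P = {}"
  proof (rule ccontr)
    assume "P \<noteq> {}"
    then have "(\<Sum>x\<in>P. f x * (x \<bullet> y0)) > 0"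
      using fin pos by (intro sum_pos) (auto simp: P_def)
    then show False using v0 by (simp add: v_def inner_sum_left[symmetric] flip: inner_scaleR_left)
  qed
  moreover have "N = {}"
  proof (rule ccontr)
    assume "N \<noteq> {}"
    then have "(\<Sum>x\<in>N. (- f x) * (x \<bullet> y0)) > 0"
      using fin pos by (intro sum_pos) (auto simp: N_def mult_neg_pos)
    moreover have "(\<Sum>x\<in>N. (- f x) * (x \<bullet> y0)) = v \<bullet> y0"
      unfolding v_def eq by (simp add: inner_sum_left)
    ultimately show False using v0 by simp
  qed
  ultimately show "f a = 0" using a by (force simp: P_def N_def)
qed

lemma fixed_by_simple_imp_zero:
  assumes "\<And>s. s \<in> S \<Longrightarrow> s x = x" shows "x = 0"
proof (rule essential)
  fix w assume "w \<in> W"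
  then obtain ws where "set ws \<subseteq> S" "word_prod ws = w" using W_word_in_S by blast
  moreover have "set ws \<subseteq> S \<Longrightarrow> word_prod ws x = x" for ws
    using assms by (induction ws) auto
  ultimately show "w x = x" by blast
qed

text \<open>A vector orthogonal to all simple normals is fixed by \<open>S\<close>, hence by
  \<open>W\<close>, and vanishes because the representation is essential. So the independent simple
  normals form a basis.\<close>

lemma cox_rank_eq_dim: "cox_rank W B = DIM('a)"
proof -
  have "span (normal ` S) = UNIV"
  proof (rule ccontr)
    assume "span (normal ` S) \<noteq> UNIV"
    then obtain x where "x \<noteq> 0" and x: "\<And>z. z \<in> span (normal ` S) \<Longrightarrow> orthogonal x z"
      using orthogonal_to_subspace_exists_gen[of "normal ` S" UNIV] by (metis psubsetI span_UNIV subset_UNIV)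
    have "s x = x" if "s \<in> S" for s
    proof -
      have "normal s \<bullet> x = 0"
        using x[of "normal s"] that by (simp add: span_base orthogonal_def inner_commute)
      then show ?thesis using T_fixes_iff that S_subset_T by blast
    qed
    then show False using fixed_by_simple_imp_zero \<open>x \<noteq> 0\<close> by blast
  qed
  then have "dim (UNIV :: 'a set) = card (normal ` S)"
    using simple_normals_independent by (intro dim_eq_card) auto
  then show ?thesis by (simp add: cox_rank_def card_image[OF normal_inj_on_S])
qed

lemma word_prod_displacement:
  assumes "set ws \<subseteq> T" shows "word_prod ws x - x \<in> span (normal ` set ws)"
  using assms
proof (induction ws)
  case Nil
  then show ?case by (simp add: span_zero)
next
  case (Cons t ws)
  let ?z = "word_prod ws x"
  have "t ?z - ?z = - (2 * (normal t \<bullet> ?z)) *\<^sub>R normal t"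
    using T_apply[of t ?z] Cons.prems by simp
  then have "t ?z - ?z \<in> span (normal ` set (t # ws))"
    by (metis image_eqI list.set_intros(1) span_base span_scale)
  moreover have "?z - x \<in> span (normal ` set (t # ws))"
    using Cons span_mono[of "normal ` set ws" "normal ` set (t # ws)"] by auto
  ultimately show ?case using span_add by force
qed

text \<open>If \<open>a\<close> followed by \<open>ws\<close> gives a word fixing \<open>x\<close>,
  then \<open>a x - x\<close> is a multiple of \<open>normal a\<close> and also lies in the span of
  the normals of \<open>ws\<close>. Independence makes it zero, so \<open>a\<close> fixes
  \<open>x\<close> and the argument continues with \<open>ws\<close>.\<close>

lemma fixed_by_distinct_simple_word:
  assumes "distinct ws" "set ws \<subseteq> S" "word_prod ws x = x" "s \<in> set ws"
  shows "s x = x"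
  using assms
proof (induction ws)
  case Nil
  then show ?case by simp
next
  case (Cons a ws)
  have aS: "a \<in> S" "a \<in> T" and wsS: "set ws \<subseteq> S" "set ws \<subseteq> T" using Cons.prems S_subset_T by auto
  have "a x = a (a (word_prod ws x))" using Cons.prems(3) by simp
  then have eq: "a x = word_prod ws x" using T_involution(1)[OF aS(2)] by simp
  have ax: "a x - x = - (2 * (normal a \<bullet> x)) *\<^sub>R normal a" using T_apply[OF aS(2)] by simp
  have sp: "- (2 * (normal a \<bullet> x)) *\<^sub>R normal a \<in> span (normal ` set ws)"
    using word_prod_displacement[OF wsS(2), of x] eq ax by simp
  have "normal ` set ws \<subseteq> normal ` S - {normal a}"
    using normal_inj_on_S aS wsS Cons.prems(1) by (auto simp: inj_on_def)
  then have "normal a \<notin> span (normal ` set ws)"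
    using simple_normals_independent aS(1) span_mono unfolding dependent_def by blast
  then have "normal a \<bullet> x = 0"
    using span_scale[OF sp, of "inverse (- (2 * (normal a \<bullet> x)))"] by (cases "normal a \<bullet> x = 0") auto
  then have "a x = x" using T_fixes_iff[OF aS(2)] by blast
  then show ?case using Cons eq wsS by auto
qed

lemma coxeter_element_in_W: "standard_coxeter_element W B c \<Longrightarrow> c \<in> W"
  unfolding standard_coxeter_element_def using word_prod_in_W S_subset_W by blast

lemma coxeter_element_fixes_only_zero:
  assumes "standard_coxeter_element W B c" "c x = x" shows "x = 0"
  using assms fixed_by_distinct_simple_word fixed_by_simple_imp_zero
  unfolding standard_coxeter_element_def by (metis order_refl)

text \<open>The kernel consists of the fixed vectors of \<open>c\<close>. Bijectivity makes the
  \<open>inv\<close> in \<open>delta_vec\<close> a genuine inverse.\<close>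

lemma bij_one_minus_inv_coxeter:
  assumes "standard_coxeter_element W B c"
  shows "linear (\<lambda>x. x - inv c x)" "bij (\<lambda>x. x - inv c x)"
proof -
  have cW: "c \<in> W" using coxeter_element_in_W[OF assms] .
  show lin: "linear (\<lambda>x. x - inv c x)"
    using linear_W[OF inv_in_W[OF cW]] by (intro linear_compose_sub) (auto simp: linear_id[unfolded id_def])
  have "inj (\<lambda>x. x - inv c x)"
    unfolding linear_injective_0[OF lin]
    using coxeter_element_fixes_only_zero[OF assms] W_inverse(1)[OF cW] by (metis eq_iff_diff_eq_0)
  then show "bij (\<lambda>x. x - inv c x)"
    using linear_injective_imp_surjective[OF lin] by (simp add: bij_def)
qed

subsection \<open>Chains in the absolute order\<close>

lemma length_T_comp_le:
  assumes "u \<in> W" "v \<in> W"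
  shows "length_T W (u \<circ> v) \<le> length_T W u + length_T W v"
proof -
  obtain us vs where "set us \<subseteq> T" "word_prod us = u" "length us = length_T W u"
      "set vs \<subseteq> T" "word_prod vs = v" "length vs = length_T W v"
    using T_generates assms word_length_witness by metis
  then show ?thesis using word_length_le[of "us @ vs" T] by (simp add: word_prod_append)
qed

text \<open>Let \<open>t\<close> be the first letter of a shortest reflection word for
  \<open>inv u \<circ> v\<close>. Then \<open>u \<circ> t\<close> lies weakly between
  \<open>u\<close> and \<open>v\<close> and differs from \<open>u\<close>, so in a cover it equals
  \<open>v\<close>.\<close>

lemma absolute_cover_reflection:
  assumes "absolute_cover W u v" shows "inv u \<circ> v \<in> T"
proof -
  have uv: "u \<in> W" "v \<in> W" "u \<noteq> v" "length_T W u + length_T W (inv u \<circ> v) = length_T W v"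
    and cov: "\<And>w. absolute_le W u w \<Longrightarrow> absolute_le W w v \<Longrightarrow> w = u \<or> w = v"
    using assms by (auto simp: absolute_cover_def absolute_le_def)
  have gW: "inv u \<circ> v \<in> W" using uv comp_in_W inv_in_W by blast
  obtain ts where ts: "set ts \<subseteq> T" "word_prod ts = inv u \<circ> v" "length ts = length_T W (inv u \<circ> v)"
    using T_generates[OF gW] word_length_witness by metis
  have v_eq: "u \<circ> (inv u \<circ> v) = v" using uv(1) by (simp add: fun_eq_iff)
  show ?thesis
  proof (cases ts)
    case Nil
    then show ?thesis using ts(2) v_eq uv(3) by auto
  next
    case (Cons t ts')
    have tT: "t \<in> T" and tW: "t \<in> W" using ts(1) Cons T_subset_W by auto
    let ?w = "u \<circ> t"
    have wW: "?w \<in> W" using uv(1) tW comp_in_W by blast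
    have "inv u \<circ> ?w = t" using uv(1) by (simp add: fun_eq_iff)
    have lt: "length_T W t \<le> 1" using word_length_le[of "[t]" T] tT by simp
    have "inv ?w \<circ> v = t \<circ> (inv u \<circ> v)"
      using inv_comp_W[OF uv(1) tW] T_involution(3)[OF tT] by (simp add: comp_assoc)
    also have "\<dots> = (t \<circ> t) \<circ> word_prod ts'" using ts(2) Cons by (simp add: comp_assoc flip: ts(2))
    finally have rest: "inv ?w \<circ> v = word_prod ts'" using T_involution(2)[OF tT] by simp
    have le: "length_T W (inv ?w \<circ> v) \<le> length ts'"
      unfolding rest using ts(1) Cons by (intro word_length_le) auto
    \<comment> \<open>The triangle inequality through \<open>?w\<close> gives an upper bound that
      already equals \<open>length_T W v\<close>, so every inequality involved is an
      equality.\<close>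
    have "length_T W v \<le> length_T W ?w + length_T W (inv ?w \<circ> v)"
      using length_T_comp_le[OF wW, of "inv ?w \<circ> v"] wW uv(2) inv_in_W comp_in_W
      by (metis W_inverse(3) comp_assoc id_comp)
    moreover have "length_T W ?w \<le> length_T W u + length_T W t"
      using length_T_comp_le uv(1) tW by blast
    moreover have "length_T W v = length_T W u + Suc (length ts')"
      using uv(4) ts(3) Cons by simp
    ultimately have "absolute_le W u ?w" "absolute_le W ?w v"
      using le lt uv wW \<open>inv u \<circ> ?w = t\<close> by (auto simp: absolute_le_def)
    then have "?w = u \<or> ?w = v" using cov by blast
    moreover have "?w \<noteq> u"
    proof
      assume "?w = u"
      then have "t = id" using \<open>inv u \<circ> ?w = t\<close> uv(1) by simp
      then show False using B_disjoint[OF y0_in_B tT] by simp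
    qed
    ultimately show ?thesis using \<open>inv u \<circ> ?w = t\<close> tT by auto
  qed
qed

section \<open>Positive roots\<close>

text \<open>Shows that the \<open>THE\<close> in \<open>pos_root\<close> is well defined. Existence
  comes from a root vanishing on the hyperplane of \<open>t\<close>; two candidates are positive
  multiples of each other, and \<Phi> contains only the multiples by 1 and -1 of a root.\<close>

lemma pos_root:
  assumes "root_system W \<Phi>" "t \<in> T"
  shows "\<exists>k>0. \<forall>x. pos_root B \<Phi> t x = k * (normal t \<bullet> x)"
    and "t x = x - pos_root B \<Phi> t x *\<^sub>R coroot (pos_root B \<Phi> t)"
proof -
  let ?P = "\<lambda>\<beta>. \<beta> \<in> \<Phi> \<and> (\<forall>y\<in>B. \<beta> y > 0) \<and> (\<forall>x. t x = x - \<beta> x *\<^sub>R coroot \<beta>)"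
  have lin: "linear \<phi>" "adjoint \<phi> 1 \<noteq> 0" if "\<phi> \<in> \<Phi>" for \<phi>
  proof -
    show l: "linear \<phi>" using assms(1) that by (simp add: root_system_def)
    have "\<phi> \<noteq> (\<lambda>x. 0)" using assms(1) that by (simp add: root_system_def)
    then show "adjoint \<phi> 1 \<noteq> 0" using linear_functional_inner[OF l] by (auto simp: fun_eq_iff)
  qed
  have scale: "(\<lambda>x. k * \<phi> x) \<in> \<Phi> \<longleftrightarrow> k = 1 \<or> k = -1" if "\<phi> \<in> \<Phi>" for \<phi> and k :: real
    using assms(1) that by (simp add: root_system_def)
  have multiple: "\<exists>k. \<forall>x. \<phi> x = k * (normal t \<bullet> x)" if "\<phi> \<in> \<Phi>" "reflection_along (adjoint \<phi> 1) = t" for \<phi>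
  proof -
    have "adjoint \<phi> 1 = ((adjoint \<phi> 1 \<bullet> normal t) / (normal t \<bullet> normal t)) *\<^sub>R normal t"
      using that lin assms(2) by (intro reflection_along_parallel) (auto simp: reflection_normal normal_nonzero)
    then show ?thesis using linear_functional_inner[OF lin(1)[OF that(1)]] by (metis inner_scaleR_left)
  qed
  have ex: "\<exists>\<beta>. ?P \<beta>"
  proof -
    have "fixed_space t \<in> hyperplanes W" using assms(2) by (simp add: hyperplanes_def)
    then have "fixed_space t \<in> (\<lambda>\<phi>. {x. \<phi> x = 0}) ` \<Phi>"
      using assms(1) by (simp add: root_system_def)
    then obtain \<phi> where \<phi>: "\<phi> \<in> \<Phi>" "{x. normal t \<bullet> x = 0} = {x. \<phi> x = 0}"
      using fixed_space_T[OF assms(2)] by auto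
    let ?a = "adjoint \<phi> 1"
    \<comment> \<open>The component of \<open>?a\<close> orthogonal to \<open>normal t\<close> lies
      in the common kernel, hence is orthogonal to itself and vanishes.\<close>
    have "?a \<bullet> (?a - (normal t \<bullet> ?a) *\<^sub>R normal t) = 0"
      using linear_functional_inner[OF lin(1)[OF \<phi>(1)]] \<phi>(2) norm_normal[OF assms(2)]
      by (auto simp: norm_eq_1 inner_diff_right set_eq_iff dest: spec[of _ "?a - (normal t \<bullet> ?a) *\<^sub>R normal t"])
    moreover have "normal t \<bullet> (?a - (normal t \<bullet> ?a) *\<^sub>R normal t) = 0"
      using norm_normal[OF assms(2)] by (simp add: norm_eq_1 inner_diff_right)
    ultimately have "(?a - (normal t \<bullet> ?a) *\<^sub>R normal t) \<bullet> (?a - (normal t \<bullet> ?a) *\<^sub>R normal t) = 0"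
      by (simp add: inner_diff_left)
    then have a: "?a = (normal t \<bullet> ?a) *\<^sub>R normal t" by simp
    define k where "k = normal t \<bullet> ?a"
    have k: "?a = k *\<^sub>R normal t" "k \<noteq> 0" using a lin(2)[OF \<phi>(1)] by (auto simp: k_def)
    \<comment> \<open>The factor is 1 or -1, so the functional stays in \<Phi> and becomes positive
      on \<open>B\<close>.\<close>
    define \<beta> where "\<beta> = (\<lambda>x. sgn k * \<phi> x)"
    have \<beta>: "\<beta> \<in> \<Phi>" unfolding \<beta>_def scale[OF \<phi>(1)] using k(2) by (auto simp: sgn_if)
    have \<beta>x: "\<beta> x = \<bar>k\<bar> * (normal t \<bullet> x)" for x
      using linear_functional_inner[OF lin(1)[OF \<phi>(1)], of x] k(1) by (simp add: \<beta>_def abs_sgn)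
    have "adjoint \<beta> 1 \<bullet> x = (\<bar>k\<bar> *\<^sub>R normal t) \<bullet> x" for x
      using linear_functional_inner[OF lin(1)[OF \<beta>], of x] \<beta>x by simp
    then have "adjoint \<beta> 1 = \<bar>k\<bar> *\<^sub>R normal t" using vector_eq_rdot by blast
    then have "reflection_along (adjoint \<beta> 1) = t"
      using reflection_along_scaleR[of "\<bar>k\<bar>" "normal t"] k(2) reflection_normal[OF assms(2)] by simp
    then have "?P \<beta>"
      using coroot_reflection[OF lin(1)[OF \<beta>]] \<beta> \<beta>x normal_pos[OF assms(2)] k(2) by simp
    then show ?thesis by blast
  qed
  have refl: "reflection_along (adjoint \<beta> 1) = t" if "?P \<beta>" for \<beta>
    using that coroot_reflection[of \<beta>] lin(1)[of \<beta>] by (auto simp: fun_eq_iff)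
  have posk: "\<exists>k>0. \<forall>x. \<beta> x = k * (normal t \<bullet> x)" if P\<beta>: "?P \<beta>" for \<beta>
  proof -
    obtain k where k: "\<forall>x. \<beta> x = k * (normal t \<bullet> x)" using multiple[of \<beta>] refl[OF P\<beta>] P\<beta> by blast
    then have "k > 0" using P\<beta> y0_in_B normal_y0[OF assms(2)] by (metis zero_less_mult_pos2)
    then show ?thesis using k by blast
  qed
  have uniq: "\<beta> = \<gamma>" if "?P \<beta>" "?P \<gamma>" for \<beta> \<gamma>
  proof -
    obtain k l :: real where kl: "k > 0" "\<And>x. \<beta> x = k * (normal t \<bullet> x)" "l > 0" "\<And>x. \<gamma> x = l * (normal t \<bullet> x)"
      using posk[OF \<open>?P \<beta>\<close>] posk[OF \<open>?P \<gamma>\<close>] by blast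
    then have eq: "\<beta> = (\<lambda>x. (k / l) * \<gamma> x)" by auto
    then have "k / l = 1 \<or> k / l = -1" using scale[of \<gamma> "k / l"] that by auto
    moreover have "k / l > 0" using kl by simp
    ultimately show ?thesis using eq by auto
  qed
  have P: "?P (pos_root B \<Phi> t)"
    unfolding pos_root_def using ex uniq by (intro theI'[of ?P]) blast
  show "\<exists>k>0. \<forall>x. pos_root B \<Phi> t x = k * (normal t \<bullet> x)" using posk[OF P] .
  show "t x = x - pos_root B \<Phi> t x *\<^sub>R coroot (pos_root B \<Phi> t)" using P by blast
qed

subsection \<open>Concordance and cones\<close>

lemma bruhat_le_length:
  assumes "bruhat_le W B u v" "u \<noteq> v"
  shows "length_S W B u < length_S W B v"
proof -
  have "u = v \<or> length_S W B u < length_S W B v"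
    using assms(1) unfolding bruhat_le_def
    by (induction rule: rtranclp_induct) (auto simp: bruhat_cover_def)
  then show ?thesis using assms(2) by blast
qed

lemma MC_step:
  assumes "\<pi> \<in> MC W B c" "i \<in> {1..cox_rank W B}"
  shows "\<pi> ! (i - 1) \<in> W" "chain_refl \<pi> i \<in> T" "\<pi> ! i = \<pi> ! (i - 1) \<circ> chain_refl \<pi> i"
proof -
  have cov: "absolute_cover W (\<pi> ! (i - 1)) (\<pi> ! i)" using assms by (simp add: MC_def)
  then show W: "\<pi> ! (i - 1) \<in> W" by (simp add: absolute_cover_def absolute_le_def)
  show "chain_refl \<pi> i \<in> T" unfolding chain_refl_def using absolute_cover_reflection[OF cov] .
  show "\<pi> ! i = \<pi> ! (i - 1) \<circ> chain_refl \<pi> i"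
    using W by (simp add: chain_refl_def fun_eq_iff)
qed

text \<open>Membership in \<open>W_plus\<close> fixes the total length gain along the chain at the
  rank. Strict increases at all steps are then increases by 1, that is, Bruhat covers, and each
  increase is a sign condition.\<close>

lemma concordant_iff_normal_pos:
  assumes u: "u \<in> W_plus W B c" and \<pi>: "\<pi> \<in> MC W B c"
  shows "concordant W B u \<pi> \<longleftrightarrow>
    (\<forall>i\<in>{1..cox_rank W B}. normal (chain_refl \<pi> i) \<bullet> inv (u \<circ> \<pi> ! (i - 1)) y0 > 0)"
proof -
  let ?r = "cox_rank W B"
  let ?l = "\<lambda>i. length_S W B (u \<circ> \<pi> ! i)"
  have uW: "u \<in> W" using u by (simp add: W_plus_def)
  have total: "?l ?r = ?l 0 + ?r" using u \<pi> by (simp add: W_plus_def MC_def)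
  have step: "u \<circ> \<pi> ! i = (u \<circ> \<pi> ! (i - 1)) \<circ> chain_refl \<pi> i" if "i \<in> {1..?r}" for i
    using MC_step(3)[OF \<pi> that] by (simp add: comp_assoc)
  have "concordant W B u \<pi> \<longleftrightarrow> (\<forall>i\<in>{1..?r}. ?l (i - 1) < ?l i)"
  proof
    assume con: "concordant W B u \<pi>"
    show "\<forall>i\<in>{1..?r}. ?l (i - 1) < ?l i"
    proof
      fix i assume i: "i \<in> {1..?r}"
      \<comment> \<open>\<open>bruhat_le\<close> is reflexive, so strictness requires distinct
        elements; covers in the absolute order are distinct.\<close>
      have "u \<circ> \<pi> ! (i - 1) \<noteq> u \<circ> \<pi> ! i"
      proof
        assume "u \<circ> \<pi> ! (i - 1) = u \<circ> \<pi> ! i"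
        then have "\<pi> ! (i - 1) = \<pi> ! i" using uW by (metis W_inverse(4) comp_assoc id_comp)
        moreover have "absolute_cover W (\<pi> ! (i - 1)) (\<pi> ! i)" using \<pi> i by (simp add: MC_def)
        ultimately show False by (simp add: absolute_cover_def)
      qed
      moreover have "bruhat_le W B (u \<circ> \<pi> ! (i - 1)) (u \<circ> \<pi> ! i)"
        using con i unfolding concordant_def by blast
      ultimately show "?l (i - 1) < ?l i" using bruhat_le_length by blast
    qed
  next
    assume inc: "\<forall>i\<in>{1..?r}. ?l (i - 1) < ?l i"
    have less: "?l i < ?l (Suc i)" if "i < ?r" for i using bspec[OF inc, of "Suc i"] that by simp
    have cover: "?l i = ?l (i - 1) + 1" if "i \<in> {1..?r}" for i
      using unit_steps_of_total[of ?r ?l "i - 1", OF less total] that by force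
    have "bruhat_cover W B (u \<circ> \<pi> ! (i - 1)) (u \<circ> \<pi> ! i)" if i: "i \<in> {1..?r}" for i
      unfolding bruhat_cover_def
      using comp_in_W[OF uW MC_step(1)[OF \<pi> i]] MC_step(2)[OF \<pi> i] step[OF i] cover[OF i] by blast
    then show "concordant W B u \<pi>" unfolding concordant_def bruhat_le_def by blast
  qed
  also have "\<dots> \<longleftrightarrow>
      (\<forall>i\<in>{1..?r}. normal (chain_refl \<pi> i) \<bullet> inv (u \<circ> \<pi> ! (i - 1)) y0 > 0)"
    using length_S_increases_iff[OF comp_in_W[OF uW MC_step(1)[OF \<pi>]] MC_step(2)[OF \<pi>]] step
    by (intro ball_cong) auto
  finally show ?thesis .
qed

text \<open>It suffices to compare both sides after applying the injective map \<open>?D\<close>. It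
  turns the \<delta>-vectors into coroots, and the reflection formula makes each summand a
  difference of consecutive terms.\<close>

lemma delta_expansion:
  assumes \<Phi>: "root_system W \<Phi>" and c: "standard_coxeter_element W B c" and \<pi>: "\<pi> \<in> MC W B c"
  shows "x = (\<Sum>i=1..cox_rank W B. pos_root B \<Phi> (chain_refl \<pi> i) (inv (\<pi> ! (i - 1)) x)
    *\<^sub>R delta_vec B \<Phi> c (chain_refl \<pi> i))" (is "x = ?rhs")
proof -
  let ?r = "cox_rank W B"
  let ?D = "\<lambda>x. x - inv c x"
  let ?\<beta> = "\<lambda>i. pos_root B \<Phi> (chain_refl \<pi> i)"
  have lin: "linear ?D" and bij: "bij ?D" using bij_one_minus_inv_coxeter[OF c] by auto
  have step: "inv (\<pi> ! (i - 1)) x - inv (\<pi> ! i) x = ?\<beta> i (inv (\<pi> ! (i - 1)) x) *\<^sub>R coroot (?\<beta> i)"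
    if i: "i \<in> {1..?r}" for i
  proof -
    note t = MC_step(2)[OF \<pi> i]
    have "inv (\<pi> ! i) = chain_refl \<pi> i \<circ> inv (\<pi> ! (i - 1))"
      using MC_step(3)[OF \<pi> i] inv_comp_W[OF MC_step(1)[OF \<pi> i] T_subset_W[OF t]]
        T_involution(3)[OF t] by simp
    then show ?thesis using pos_root(2)[OF \<Phi> t, of "inv (\<pi> ! (i - 1)) x"] by simp
  qed
  have "?D (delta_vec B \<Phi> c t) = coroot (pos_root B \<Phi> t)" for t
    unfolding delta_vec_def using bij by (intro surj_f_inv_f[of ?D]) (simp add: bij_def)
  then have "?D ?rhs = (\<Sum>i=1..?r. ?\<beta> i (inv (\<pi> ! (i - 1)) x) *\<^sub>R coroot (?\<beta> i))"
    unfolding linear_sum[OF lin] linear_cmul[OF lin] by simp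
  also have "\<dots> = (\<Sum>i=1..?r. inv (\<pi> ! (i - 1)) x - inv (\<pi> ! i) x)"
    using step by simp
  \<comment> \<open>The differences run from earlier to later terms, hence the negated sequence in
    the telescoping.\<close>
  also have "\<dots> = inv (\<pi> ! 0) x - inv (\<pi> ! ?r) x"
    using sum_telescope''[of 0 ?r "\<lambda>i. - inv (\<pi> ! i) x"] by (simp add: atLeastSucAtMost_greaterThanAtMost)
  also have "\<dots> = ?D x"
    using \<pi> by (simp add: MC_def inv_id[unfolded id_def] id_def)
  finally show ?thesis using bij by (metis (no_types, lifting) bij_def injD)
qed

text \<open>The expansion shows that the \<delta>-vectors span; there are as many as the dimension,
  so its coefficients are the only ones. Their signs are those of the pairings with the
  normals.\<close>

lemma Delta_chain_iff:
  assumes \<Phi>: "root_system W \<Phi>" and c: "standard_coxeter_element W B c" and \<pi>: "\<pi> \<in> MC W B c"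
  shows "x \<in> Delta_chain W B \<Phi> c \<pi> \<longleftrightarrow>
    (\<forall>i\<in>{1..cox_rank W B}. normal (chain_refl \<pi> i) \<bullet> inv (\<pi> ! (i - 1)) x \<ge> 0)"
proof -
  let ?r = "cox_rank W B"
  let ?d = "\<lambda>i. delta_vec B \<Phi> c (chain_refl \<pi> i)"
  let ?b = "\<lambda>i. pos_root B \<Phi> (chain_refl \<pi> i) (inv (\<pi> ! (i - 1)) x)"
  note expand = delta_expansion[OF assms]
  have span: "span (?d ` {1..?r}) = UNIV"
  proof -
    have "z \<in> span (?d ` {1..?r})" for z
      by (subst expand[of z]) (intro span_sum span_scale span_base imageI)
    then show ?thesis by blast
  qed
  have "x \<in> Delta_chain W B \<Phi> c \<pi> \<longleftrightarrow> (\<forall>i\<in>{1..?r}. ?b i \<ge> 0)"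
  proof
    assume "x \<in> Delta_chain W B \<Phi> c \<pi>"
    then obtain a where a: "x = (\<Sum>i=1..?r. a i *\<^sub>R ?d i)" "\<forall>i. a i \<ge> 0"
      unfolding Delta_chain_def by blast
    then have "a i = ?b i" if "i \<in> {1..?r}" for i
      using spanning_family_coefficients_unique[OF _ _ span _ that, of a ?b] expand[of x]
      by (simp add: cox_rank_eq_dim)
    then show "\<forall>i\<in>{1..?r}. ?b i \<ge> 0" using a(2) by metis
  next
    assume b: "\<forall>i\<in>{1..?r}. ?b i \<ge> 0"
    \<comment> \<open>\<open>Delta_chain\<close> asks for nonnegative coefficients at all natural
      indices, so those outside the range are set to 0.\<close>
    have "(\<Sum>i=1..?r. ?b i *\<^sub>R ?d i) = (\<Sum>i=1..?r. (if i \<in> {1..?r} then ?b i else 0) *\<^sub>R ?d i)"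
      by (rule sum.cong) simp_all
    then have "x = (\<Sum>i=1..?r. (if i \<in> {1..?r} then ?b i else 0) *\<^sub>R ?d i)"
      using expand[of x] by (rule trans[rotated])
    then show "x \<in> Delta_chain W B \<Phi> c \<pi>"
      unfolding Delta_chain_def using b by fastforce
  qed
  also have "\<dots> \<longleftrightarrow> (\<forall>i\<in>{1..?r}. normal (chain_refl \<pi> i) \<bullet> inv (\<pi> ! (i - 1)) x \<ge> 0)"
  proof (intro ball_cong refl)
    fix i assume "i \<in> {1..?r}"
    then obtain k where "k > 0" "\<forall>x. pos_root B \<Phi> (chain_refl \<pi> i) x = k * (normal (chain_refl \<pi> i) \<bullet> x)"
      using pos_root(1)[OF \<Phi> MC_step(2)[OF \<pi>]] by blast
    then show "?b i \<ge> 0 \<longleftrightarrow> normal (chain_refl \<pi> i) \<bullet> inv (\<pi> ! (i - 1)) x \<ge> 0"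
      by (simp add: zero_le_mult_iff)
  qed
  finally show ?thesis .
qed

text \<open>A translate of \<open>B\<close> lies strictly on one side of each hyperplane. So the
  weak inequality on its closure is equivalent to the strict one at the image of
  \<open>y0\<close>.\<close>

lemma Delta_elem_subset_halfspace_iff:
  assumes "u \<in> W" "v \<in> W" "t \<in> T"
  shows "(\<forall>x\<in>Delta_elem B u. normal t \<bullet> inv v x \<ge> 0) \<longleftrightarrow> normal t \<bullet> inv (u \<circ> v) y0 > 0"
proof -
  have uvW: "u \<circ> v \<in> W" using assms comp_in_W by blast
  have inv_uv: "inv (u \<circ> v) y = inv v (inv u y)" for y using inv_comp_W[OF assms(1,2)] by simp
  show ?thesis
  proof
    assume "\<forall>x\<in>Delta_elem B u. normal t \<bullet> inv v x \<ge> 0"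
    moreover have "inv u y0 \<in> Delta_elem B u"
      unfolding Delta_elem_def using y0_in_B by (intro closure_subset[THEN subsetD] imageI)
    ultimately show "normal t \<bullet> inv (u \<circ> v) y0 > 0"
      using sign_on_translate(1)[OF uvW assms(3) y0_in_B] inv_uv by (metis less_eq_real_def)
  next
    assume pos: "normal t \<bullet> inv (u \<circ> v) y0 > 0"
    let ?H = "{x. v (normal t) \<bullet> x \<ge> 0}"
    have "v (normal t) \<bullet> inv u y > 0" if "y \<in> B" for y
      using sign_on_translate(2)[OF uvW assms(3) that] pos inv_uv inner_inv_W[OF assms(2)] by simp
    then have "inv u ` B \<subseteq> ?H" by (auto intro: less_imp_le)
    then have "Delta_elem B u \<subseteq> ?H"
      unfolding Delta_elem_def by (intro closure_minimal closed_halfspace_ge)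
    then show "\<forall>x\<in>Delta_elem B u. normal t \<bullet> inv v x \<ge> 0"
      using inner_inv_W[OF assms(2)] by auto
  qed
qed

end

theorem theorem1p14:
  fixes W :: "('a::euclidean_space \<Rightarrow> 'a) set"
    and B :: "'a set"
    and \<Phi> :: "('a \<Rightarrow> real) set"
    and c u :: "'a \<Rightarrow> 'a"
    and \<pi> :: "('a \<Rightarrow> 'a) list"
  assumes "finite_coxeter_group W"
    and "base_region W B"
    and "root_system W \<Phi>"
    and "standard_coxeter_element W B c"
    and "u \<in> W_plus W B c"
    and "\<pi> \<in> MC W B c"
  shows "concordant W B u \<pi> \<longleftrightarrow> Delta_elem B u \<subseteq> Delta_chain W B \<Phi> c \<pi>"
proof -
  interpret coxeter_chamber W B using assms(1,2) by unfold_locales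
  have uW: "u \<in> W" using assms(5) by (simp add: W_plus_def)
  have "Delta_elem B u \<subseteq> Delta_chain W B \<Phi> c \<pi> \<longleftrightarrow>
      (\<forall>i\<in>{1..cox_rank W B}. \<forall>x\<in>Delta_elem B u. normal (chain_refl \<pi> i) \<bullet> inv (\<pi> ! (i - 1)) x \<ge> 0)"
    using Delta_chain_iff[OF assms(3,4,6)] by blast
  also have "\<dots> \<longleftrightarrow>
      (\<forall>i\<in>{1..cox_rank W B}. normal (chain_refl \<pi> i) \<bullet> inv (u \<circ> \<pi> ! (i - 1)) y0 > 0)"
    using Delta_elem_subset_halfspace_iff[OF uW MC_step(1)[OF assms(6)] MC_step(2)[OF assms(6)]]
    by (intro ball_cong refl) blast
  finally show ?thesis using concordant_iff_normal_pos[OF assms(5,6)] by blast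
qed

end
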